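(* Let $\to_0$ and $\to_1$ be binary relations. Set $\to_2\;:=\;\to_0^*\circ\to_1$ and $\to_3\;:=\;\to_0\cup\to_1$. Let $a\in\mathrm{dom}(\to_3)$, and let $a'$ be a $\to_3$-normal form of $a$. Set $A:=\{b : a\to_3^* b\}$ and $\to_4\;:=\;\{(b,c)\in\to_3 : b\in A\}$. Suppose the following four conditions hold. 1. The relation $\{(c,b) : b\to_0 c,\ b\in A\}$ is well-founded. 2. There is $n\in\mathbb N$ with the following property. For every $m\in\mathbb N$ and every sequence $b_0,\dots,b_m$ with $b_0=a$, $b_i\to_2 b_{i+1}$ for each $i\in\{0,\dots,m-1\}$, and $b_m\to_0^* a'$, we have $m\le n$. 3. For all $b_1,b_2$: if there is $c$ with $c\to_4 b_1$ and $c\to_1 b_2$, then there is $d$ with $b_1\to_4^* d$ and $b_2\to_4^* d$. 4. For all $b_1,b_2$: if there is $c$ with $c\to_4 b_1$ and $c\to_0 b_2$, then there is $d$ with $b_1\to_4^* d$ and either $b_2=d$ or $b_2\to_4 d$. Then the reverse relation $\{(c,b): b\to_4 c\}$ is well-founded.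
   Context: For a binary relation $R$: - $R^*$ denotes its reflexive transitive closure. - $\mathrm{dom}(R)=\{a:\exists b.\,(a,b)\in R\}$. - The composition $R\circ S$ is $\{(a,c): \exists b.\ (a,b)\in R,\ (b,c)\in S\}$. An element $a'$ is an $R$-normal form of $a$ iff $a R^* a'$ and $a'\notin\mathrm{dom}(R)$. A relation $R$ is well-founded iff every non-empty class $B$ has an $R$-minimal element, i.e. some $a\in B$ such that there is no $a'\in B$ with $a' R\, a$. *)

theory Defs imports Main begin

definition is_normal_form :: "('a \<times> 'a) set \<Rightarrow> 'a \<Rightarrow> 'a \<Rightarrow> bool" where
  "is_normal_form R a a' \<longleftrightarrow> (a, a') \<in> R\<^sup>* \<and> a' \<notin> Domain R"

end

theory Submission imports Defs begin

text \<open>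
  Call an element of \<open>A\<close> good if it reduces to \<open>a'\<close>. For a good element, the number of
  \<open>R1\<close>-steps in a reduction to \<open>a'\<close> is bounded, and its maximum decreases along
  \<open>R1\<close>-steps and does not increase along \<open>R0\<close>-steps between good elements. Combined
  lexicographically with the well-foundedness of \<open>R0\<close> on \<open>A\<close>, this makes every step between
  good elements decrease a well-founded order. By induction on this order, reducts of good elements
  are good: a good element other than \<open>a'\<close> has a good, hence smaller, successor \<open>c\<close>, and by
  the confluence conditions every other successor has a common reduct with \<open>c\<close>. So all of
  \<open>A\<close> is good, and \<open>R4\<close> itself decreases the order.
\<close>

text \<open>Counts the \<open>S\<close>-steps of a reduction. Grouping each \<open>S\<close>-step
  with the \<open>R\<close>-steps before it yields a power of \<open>R\<^sup>* O S\<close>, the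
  shape of the sequences bounded in \<open>cond2\<close>.\<close>

definition reduces_in :: "('a \<times> 'a) set \<Rightarrow> ('a \<times> 'a) set \<Rightarrow> nat \<Rightarrow> ('a \<times> 'a) set" where
  "reduces_in R S k = (R\<^sup>* O S) ^^ k O R\<^sup>*"

text \<open>The trailing \<open>R\<close>-steps of the first reduction are absorbed by the first
  \<open>R\<^sup>* O S\<close> block of the second, or by its own trailing \<open>R\<close>-steps if
  \<open>k = 0\<close>.\<close>

lemma reduces_in_add:
  assumes "(x, y) \<in> reduces_in R S j" and "(y, z) \<in> reduces_in R S k"
  shows "(x, z) \<in> reduces_in R S (j + k)"
proof -
  from assms(1) obtain u where u: "(x, u) \<in> (R\<^sup>* O S) ^^ j" "(u, y) \<in> R\<^sup>*"
    unfolding reduces_in_def by blast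
  from assms(2) obtain v where v: "(y, v) \<in> (R\<^sup>* O S) ^^ k" "(v, z) \<in> R\<^sup>*"
    unfolding reduces_in_def by blast
  have "(u, z) \<in> (R\<^sup>* O S) ^^ k O R\<^sup>*"
  proof (cases k)
    case 0
    then show ?thesis using u v by auto
  next
    case (Suc k')
    then obtain w where w: "(y, w) \<in> R\<^sup>* O S" "(w, v) \<in> (R\<^sup>* O S) ^^ k'"
      using v(1) relpow_Suc_D2 by metis
    have "(u, w) \<in> R\<^sup>* O S"
      using u(2) w(1) by (blast intro: rtrancl_trans)
    then have "(u, v) \<in> (R\<^sup>* O S) ^^ k"
      unfolding Suc using w(2) by (rule relpow_Suc_I2)
    then show ?thesis using v(2) by blast
  qed
  then show ?thesis
    using u(1) unfolding reduces_in_def by (auto simp: relpow_add)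
qed

lemma reduces_in_left: "(x, y) \<in> R \<Longrightarrow> (x, y) \<in> reduces_in R S 0"
  by (auto simp: reduces_in_def)

lemma reduces_in_right: "(x, y) \<in> S \<Longrightarrow> (x, y) \<in> reduces_in R S (Suc 0)"
  by (auto simp: reduces_in_def)

lemma rtrancl_Un_imp_reduces_in:
  assumes "(x, y) \<in> (R \<union> S)\<^sup>*"
  shows "\<exists>k. (x, y) \<in> reduces_in R S k"
  using assms
proof (induction rule: rtrancl_induct)
  case base
  have "(x, x) \<in> reduces_in R S 0" by (auto simp: reduces_in_def)
  then show ?case by blast
next
  case (step y z)
  then show ?case
    by (blast intro: reduces_in_add reduces_in_left reduces_in_right)
qed

theorem theorem2p2:
  fixes R0 R1 R2 R3 R4 :: "('a \<times> 'a) set" and A :: "'a set" and a a' :: 'a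
  assumes R2: "R2 = R0\<^sup>* O R1"
    and R3: "R3 = R0 \<union> R1"
    and a: "a \<in> Domain R3"
    and a': "is_normal_form R3 a a'"
    and A: "A = {b. (a, b) \<in> R3\<^sup>*}"
    and R4: "R4 = {(b, c). (b, c) \<in> R3 \<and> b \<in> A}"
    and cond1: "wf {(c, b). (b, c) \<in> R0 \<and> b \<in> A}"
    and cond2: "\<exists>n::nat. \<forall>m::nat. \<forall>b :: nat \<Rightarrow> 'a.
      b 0 = a \<and> (\<forall>i<m. (b i, b (Suc i)) \<in> R2) \<and> (b m, a') \<in> R0\<^sup>* \<longrightarrow> m \<le> n"
    and cond3: "\<And>b\<^sub>1 b\<^sub>2. (\<exists>c. (c, b\<^sub>1) \<in> R4 \<and> (c, b\<^sub>2) \<in> R1) \<Longrightarrow>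
      (\<exists>d. (b\<^sub>1, d) \<in> R4\<^sup>* \<and> (b\<^sub>2, d) \<in> R4\<^sup>*)"
    and cond4: "\<And>b\<^sub>1 b\<^sub>2. (\<exists>c. (c, b\<^sub>1) \<in> R4 \<and> (c, b\<^sub>2) \<in> R0) \<Longrightarrow>
      (\<exists>d. (b\<^sub>1, d) \<in> R4\<^sup>* \<and> (b\<^sub>2 = d \<or> (b\<^sub>2, d) \<in> R4))"
  shows "wf {(c, b). (b, c) \<in> R4}"
proof -
  define K where "K x = {k. (x, a') \<in> reduces_in R0 R1 k}" for x
  \<comment> \<open>For \<open>x\<close> in \<open>A\<close> reducing to \<open>a'\<close>,
    \<open>K x\<close> is finite and nonempty, so the maximum is attained; \<open>decr\<close>
    compares only such \<open>x\<close>.\<close>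
  define N where "N x = Max (K x)" for x
  define Z where "Z = {(c, b). (b, c) \<in> R0 \<and> b \<in> A}"
  define L where "L = inv_image (less_than <*lex*> Z) (\<lambda>x. (N x, x))"
  have nf: "a' \<notin> Domain R3" and good_a: "(a, a') \<in> R3\<^sup>*"
    using a' by (auto simp: is_normal_form_def)
  have wfL: "wf L"
    using cond1 unfolding L_def Z_def by blast
  have closed: "c \<in> A" if "b \<in> A" "(b, c) \<in> R3\<^sup>*" for b c
    using that unfolding A by (auto intro: rtrancl_trans)
  have R4_R3: "(b, c) \<in> R3\<^sup>*" if "(b, c) \<in> R4\<^sup>*" for b c
    using that rtrancl_mono[of R4 R3] R4 by blast
  have K_ne: "K x \<noteq> {}" if "(x, a') \<in> R3\<^sup>*" for x
    using rtrancl_Un_imp_reduces_in[of x a' R0 R1] that unfolding K_def R3 by blast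
  have finK: "finite (K x)" if x: "x \<in> A" for x
  proof -
    obtain n where n: "\<forall>m b. b 0 = a \<and> (\<forall>i<m. (b i, b (Suc i)) \<in> R2) \<and>
        (b m, a') \<in> R0\<^sup>* \<longrightarrow> m \<le> n"
      using cond2 by (elim exE)
    have bound: "m \<le> n" if m: "(a, a') \<in> reduces_in R0 R1 m" for m
    proof -
      obtain u where "(a, u) \<in> R2 ^^ m" and u: "(u, a') \<in> R0\<^sup>*"
        using m unfolding reduces_in_def R2 by blast
      then obtain f where "f 0 = a" "f m = u" "\<forall>i<m. (f i, f (Suc i)) \<in> R2"
        unfolding relpow_fun_conv by blast
      then show ?thesis using n[rule_format, of f m] u by simp
    qed
    \<comment> \<open>\<open>cond2\<close> speaks only of reductions from \<open>a\<close>, so a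
      fixed reduction from \<open>a\<close> to \<open>x\<close> is put before each reduction from
      \<open>x\<close> to \<open>a'\<close>.\<close>
    obtain j where j: "(a, x) \<in> reduces_in R0 R1 j"
      using x rtrancl_Un_imp_reduces_in[of a x R0 R1] unfolding A R3 by auto
    have "j + k \<le> n" if "k \<in> K x" for k
      using bound[OF reduces_in_add[OF j]] that unfolding K_def by simp
    then have "K x \<subseteq> {..n}" by (auto dest: add_leD2)
    then show ?thesis by (rule finite_subset) simp
  qed
  have decr: "(c, b) \<in> L"
    if b: "b \<in> A" and bc: "(b, c) \<in> R3" and c: "(c, a') \<in> R3\<^sup>*" for b c
  proof -
    have "c \<in> A" using closed b bc by blast
    then have Nc: "N c \<in> K c"
      unfolding N_def using finK K_ne c by (intro Max_in) auto
    show ?thesis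
    proof (cases "(b, c) \<in> R1")
      case True
      \<comment> \<open>Prepend the step to a reduction from \<open>c\<close> to \<open>a'\<close>
        that attains the maximum \<open>N c\<close>.\<close>
      then have "Suc (N c) \<in> K b"
        using reduces_in_add[OF reduces_in_right, of b c R1 a' R0 "N c"] Nc
        unfolding K_def by simp
      then have "Suc (N c) \<le> N b"
        unfolding N_def using finK[OF b] by (intro Max_ge)
      then show ?thesis unfolding L_def by auto
    next
      case False
      then have bc0: "(b, c) \<in> R0" using bc R3 by blast
      then have "N c \<in> K b"
        using reduces_in_add[OF reduces_in_left, of b c R0 a' R1 "N c"] Nc
        unfolding K_def by simp
      then have "N c \<le> N b"
        unfolding N_def using finK[OF b] by (intro Max_ge)
      \<comment> \<open>If \<open>N c = N b\<close>, the second component decides, since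
        \<open>(c, b) \<in> Z\<close>.\<close>
      then show ?thesis using bc0 b unfolding L_def Z_def by auto
    qed
  qed
  have good: "\<forall>x. (b, x) \<in> R3\<^sup>* \<longrightarrow> (x, a') \<in> R3\<^sup>*"
    if "b \<in> A" "(b, a') \<in> R3\<^sup>*" for b
    using wfL that
  proof (induction b rule: wf_induct_rule)
    case (less b)
    have IH: "(x, a') \<in> R3\<^sup>*"
      if "(b, c) \<in> R3" "(c, a') \<in> R3\<^sup>*" "(c, x) \<in> R3\<^sup>*" for c x
    proof -
      have "(c, b) \<in> L" using decr less.prems(1) that by simp
      moreover have "c \<in> A" using closed less.prems(1) that by blast
      ultimately show ?thesis using less.IH that by simp
    qed
    have succ: "(b1, a') \<in> R3\<^sup>*" if bb1: "(b, b1) \<in> R3" for b1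
    proof -
      \<comment> \<open>The reduction from \<open>b\<close> to \<open>a'\<close> is thus nonempty;
        \<open>c\<close> is the target of its first step.\<close>
      have "b \<noteq> a'" using nf bb1 by blast
      then obtain c where bc: "(b, c) \<in> R3" and c: "(c, a') \<in> R3\<^sup>*"
        using less.prems(2) by (auto elim: converse_rtranclE)
      have "(b, b1) \<in> R4" using bb1 less.prems(1) R4 by blast
      then have "\<exists>d. (b1, d) \<in> R4\<^sup>* \<and> (c, d) \<in> R4\<^sup>*"
      proof (cases "(b, c) \<in> R1")
        case True
        then show ?thesis using \<open>(b, b1) \<in> R4\<close> by (intro cond3) blast
      next
        case False
        then have "(b, c) \<in> R0" using bc R3 by blast
        then have "\<exists>d. (b1, d) \<in> R4\<^sup>* \<and> (c = d \<or> (c, d) \<in> R4)"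
          using \<open>(b, b1) \<in> R4\<close> by (intro cond4) blast
        then show ?thesis by blast
      qed
      then obtain d where d: "(b1, d) \<in> R4\<^sup>*" "(c, d) \<in> R4\<^sup>*"
        by blast
      \<comment> \<open>The induction hypothesis at \<open>c\<close> covers all reducts of
        \<open>c\<close>, in particular the common reduct \<open>d\<close>, through which
        \<open>b1\<close> then reaches \<open>a'\<close>.\<close>
      then have "(d, a') \<in> R3\<^sup>*"
        using IH[OF bc c] R4_R3 by simp
      then show ?thesis
        using R4_R3[OF d(1)] by (rule rtrancl_trans[rotated])
    qed
    show ?case
    proof (intro allI impI)
      \<comment> \<open>For a nonempty reduction, \<open>succ\<close> makes its first reduct good,
        so the induction hypothesis applies there as well.\<close>
      fix x assume "(b, x) \<in> R3\<^sup>*"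
      then show "(x, a') \<in> R3\<^sup>*"
        using less.prems(2) IH succ by (cases rule: converse_rtranclE) simp_all
    qed
  qed
  have "{(c, b). (b, c) \<in> R4} \<subseteq> L"
  proof clarify
    fix b c assume "(b, c) \<in> R4"
    then have "b \<in> A" and bc: "(b, c) \<in> R3" using R4 by auto
    then have "(a, c) \<in> R3\<^sup>*" using A by (auto intro: rtrancl_into_rtrancl)
    then have "(c, a') \<in> R3\<^sup>*"
      using good[of a] good_a unfolding A by blast
    then show "(c, b) \<in> L" using decr bc \<open>b \<in> A\<close> by blast
  qed
  then show ?thesis using wfL by (rule wf_subset[rotated])
qed

end
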